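(* Let $k\ge 0$, $m \ge 1$ and $0\le x<2^k$ be integers, and let $$G = \mathfrak{G}(2^{k+1} - 1, m, x) = [2^{k+1}-1,\; 2^{k+1}m+x,\; 2^{k+1}m+2^{k+1}-1-x].$$ Then $$V(\mathfrak{G}(2^{k+1} - 1, m - 1, 0)) + 2(2^{k+1} - 1) - 2x \;\leq\; V(G) \;\leq\; V(\mathfrak{G}(2^{k+1} - 1, m + 1, 0)) - 2(2^{k+1} - 1) + 2x.$$
   Context: Candy Nim is played with the positions and moves of Nim: a position $[a_1,\dots,a_p]$ consists of $p$ piles with $a_i \ge 0$ candies, and in a move a player removes a positive number of candies from one pile. Players alternate; the player taking the last candy wins. A position is a $\mathcal{P}$ position if the bitwise XOR (nim-sum) $a_1\oplus\cdots\oplus a_p$ is $0$ (the player to move loses the underlying Nim game), and an $\mathcal{N}$ position otherwise. The losing player is called Luca and the winning player Windsor: in a $\mathcal{P}$ position it is Luca's turn, in an $\mathcal{N}$ position it is Windsor's turn. Luca may make any move; Windsor is forced to make winning Nim moves, i.e. each of his moves must lead to a $\mathcal{P}$ position. Subject to this, each player tries to collect as many candies as possible. For a position $G$, $N_L(G)$ and $N_W(G)$ are the numbers of candies collected by Luca and Windsor under optimal play (minimax), and the value of $G$ is $V(G) = N_L(G) - N_W(G)$. For integers $a\ge1$, $k=\lfloor\log_2 a\rfloor$, $m\ge 0$ and $0\le x<2^k$, write $\mathfrak{G}(a,m,x) = [a,\; 2^{k+1}m+x,\; 2^{k+1}m+(a\oplus x)]$. In particular $\mathfrak{G}(2^{k+1}-1,m,0)=[2^{k+1}-1,\,2^{k+1}m,\,2^{k+1}(m+1)-1]$,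 and for $m=0$ this is $[2^{k+1}-1,\,0,\,2^{k+1}-1]$. *)

theory Defs
  imports Complex_Main
begin

unbundle bit_operations_syntax

text \<open>A position is the list of its pile sizes; empty piles are allowed.\<close>

definition nim_moves :: "nat list \<Rightarrow> nat list set" where
  "nim_moves G = {G[i := j] | i j. i < length G \<and> j < G ! i}"

definition nim_sum :: "nat list \<Rightarrow> nat" where
  "nim_sum G = foldr (XOR) G 0"

definition P_position :: "nat list \<Rightarrow> bool" where
  "P_position G \<longleftrightarrow> nim_sum G = 0"

definition winning_moves :: "nat list \<Rightarrow> nat list set" where
  "winning_moves G = {H \<in> nim_moves G. P_position H}"

lemma sum_list_nim_moves: "H \<in> nim_moves G \<Longrightarrow> sum_list H < sum_list G"
proof -
  assume "H \<in> nim_moves G"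
  then obtain i j where ij: "i < length G" "j < G ! i" "H = G[i := j]"
    by (auto simp: nim_moves_def)
  have "G ! i \<le> sum_list G"
    using ij(1) by (simp add: elem_le_sum_list)
  then show ?thesis
    using ij by (simp add: sum_list_update)
qed

text \<open>
  Minimax values. A move from \<open>G\<close> to \<open>H\<close> collects \<open>sum_list G - sum_list H\<close> candies. It is
  Luca's turn in P positions, with all moves available to him, and Windsor's turn in the other
  (N) positions, where only the winning moves are available. Each player maximizes the number of
  candies he collects; as all candies are eventually collected by one of the two players, this
  amounts to minimizing the number of candies collected by the opponent. The sets under \<open>MAX\<close>
  and \<open>MIN\<close> are finite and nonempty: the terminal positions are treated separately, and every
  N position has a winning move.
\<close>

function luca_candies :: "nat list \<Rightarrow> nat" where
  "luca_candies G =
     (if nim_moves G = {} then 0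
      else if P_position G
      then (MAX H \<in> nim_moves G. (sum_list G - sum_list H) + luca_candies H)
      else (MIN H \<in> winning_moves G. luca_candies H))"
  by auto
termination
  by (relation "measure sum_list") (auto simp: winning_moves_def sum_list_nim_moves)

function windsor_candies :: "nat list \<Rightarrow> nat" where
  "windsor_candies G =
     (if nim_moves G = {} then 0
      else if P_position G
      then (MIN H \<in> nim_moves G. windsor_candies H)
      else (MAX H \<in> winning_moves G. (sum_list G - sum_list H) + windsor_candies H))"
  by auto
termination
  by (relation "measure sum_list") (auto simp: winning_moves_def sum_list_nim_moves)

declare luca_candies.simps [simp del] windsor_candies.simps [simp del]

definition candy_value :: "nat list \<Rightarrow> int" where
  "candy_value G = int (luca_candies G) - int (windsor_candies G)"

text \<open>Meant for \<open>a \<ge> 1\<close> and \<open>x < 2 ^ k\<close>, where \<open>k = \<lfloor>log 2 a\<rfloor>\<close>.\<close>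

definition frak_G :: "nat \<Rightarrow> nat \<Rightarrow> nat \<Rightarrow> nat list" where
  "frak_G a m x =
     (let k = nat \<lfloor>log 2 (real a)\<rfloor>
      in [a, 2 ^ (k + 1) * m + x, 2 ^ (k + 1) * m + (a XOR x)])"

lemma frak_G_mersenne:
  fixes k m x :: nat
  assumes "x < 2 ^ k"
  shows "frak_G (2 ^ (k + 1) - 1) m x =
    [2 ^ (k + 1) - 1, 2 ^ (k + 1) * m + x, 2 ^ (k + 1) * m + 2 ^ (k + 1) - 1 - x]"
proof -
  have ge: "(2::nat) ^ k \<le> 2 ^ (k + 1) - 1"
    by simp
  have "\<lfloor>log 2 (real (2 ^ (k + 1) - 1))\<rfloor> = int k"
    using ge floor_log_nat_eq_if[of 2 k "2 ^ (k + 1) - 1"] by simp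
  then have k: "nat \<lfloor>log 2 (real (2 ^ (k + 1) - 1))\<rfloor> = k"
    by simp
  have xor: "x < 2 ^ n \<Longrightarrow> (2 ^ n - 1) XOR x = 2 ^ n - 1 - x" for n
  proof (induction n arbitrary: x)
    case (Suc n)
    have "x div 2 < 2 ^ n"
      using Suc.prems by auto
    note IH = Suc.IH[OF this]
    have half: "(2 ^ Suc n - 1) div 2 = 2 ^ n - (1::nat)"
      unfolding power_Suc by presburger
    have odd: "odd (2 ^ Suc n - 1 :: nat)"
      by simp
    have "(2 ^ Suc n - 1) XOR x = of_bool (even x) + 2 * (2 ^ n - 1 - x div 2)"
      by (subst xor_nat_rec) (use odd in \<open>simp add: half IH del: power_Suc One_nat_def\<close>)
    also have "\<dots> = 2 ^ Suc n - 1 - x"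
      using Suc.prems by (cases "even x") (auto elim!: evenE oddE)
    finally show ?case .
  qed simp
  have "x < 2 ^ (k + 1)"
    using assms by simp
  from xor[OF this] show ?thesis
    using \<open>x < 2 ^ (k + 1)\<close> unfolding frak_G_def Let_def k by simp
qed

end

theory Submission
  imports Defs "HOL-Library.Multiset"
begin

text \<open>
  Both inequalities are instances of one strategy of Luca. Write \<open>n = 2 ^ K\<close> with \<open>K = k + 1\<close>,
  and consider the P positions \<open>[n - 1, n * m + x, n * m + (n - 1 - x)]\<close>, where \<open>m\<close> is the level
  and \<open>x < n\<close> the offset. From level \<open>m + 1\<close> and offset \<open>x\<close>, Luca can steer the game to level \<open>m\<close>
  with any offset \<open>y < n\<close> that he likes: he cuts the third pile down to \<open>n * m + y\<close>, and now the
  second and third piles have different quotients by \<open>n\<close>. The pile \<open>n - 1\<close> is too small to repair this, so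
  Windsor's only winning move is to bring the second pile down to level \<open>m\<close>, to
  \<open>n * m + (n - 1 - y)\<close>. Luca has taken \<open>2 * n - 1 - x - y\<close> candies and Windsor \<open>x + y + 1\<close>, so
  that Luca is ahead by \<open>2 * (n - 1) - 2 * x - 2 * y\<close> (lemma \<open>candy_value_descend\<close>).

  The lower bound for \<open>G\<close> is the descent from \<open>G\<close> to offset \<open>0\<close> at level \<open>m - 1\<close>; the upper bound
  is the descent from offset \<open>0\<close> at level \<open>m + 1\<close> to \<open>G\<close>.
\<close>

section \<open>Independence of the order of the piles\<close>

text \<open>
  Whether a move is winning and how many candies it collects depends only on the multiset of pile
  sizes, so the order of the piles is irrelevant. This is needed since Windsor's forced reply
  produces the piles of the level below in the opposite order.
\<close>

lemma nim_moves_permuted: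
  assumes "mset G = mset G'" and "H \<in> nim_moves G"
  obtains H' where "H' \<in> nim_moves G'" and "mset H = mset H'"
proof -
  obtain i j where ij: "i < length G" "j < G ! i" "H = G[i := j]"
    using assms(2) by (auto simp: nim_moves_def)
  have "G ! i \<in> set G'"
    using ij(1) assms(1) by (metis mset_eq_setD nth_mem)
  then obtain i' where i': "i' < length G'" "G' ! i' = G ! i"
    by (auto simp: in_set_conv_nth)
  show thesis
  proof
    show "G'[i' := j] \<in> nim_moves G'"
      using i' ij(2) unfolding nim_moves_def by fastforce
    show "mset H = mset (G'[i' := j])"
      using i' ij assms(1) by (simp add: mset_update)
  qed
qed

lemma P_position_permuted:
  assumes "mset G = mset G'"
  shows "P_position G \<longleftrightarrow> P_position G'"
proof -
  have "fold (XOR) (rev G) 0 = fold (XOR) (rev G') (0::nat)"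
    by (rule fold_permuted_eq[where P = "\<lambda>_. True"]) (simp_all add: assms xor.left_commute)
  then show ?thesis
    by (simp add: P_position_def nim_sum_def foldr_conv_fold)
qed

lemma image_nim_moves_permuted:
  assumes perm: "mset G = mset G'"
    and F: "\<And>H H'. H \<in> nim_moves G \<Longrightarrow> mset H = mset H' \<Longrightarrow> F H = F H'"
  shows "F ` nim_moves G = F ` nim_moves G'"
    and "F ` winning_moves G = F ` winning_moves G'"
proof -
  have 1: "\<exists>H' \<in> nim_moves G'. F H = F H' \<and> (P_position H \<longleftrightarrow> P_position H')"
    if "H \<in> nim_moves G" for H
    using that nim_moves_permuted[OF perm that] F P_position_permuted by metis
  have 2: "\<exists>H \<in> nim_moves G. F H = F H' \<and> (P_position H \<longleftrightarrow> P_position H')"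
    if "H' \<in> nim_moves G'" for H'
    using that nim_moves_permuted[OF perm[symmetric] that] F P_position_permuted by metis
  show "F ` nim_moves G = F ` nim_moves G'"
    using 1 2 by (intro equalityI image_subsetI) (metis imageI)+
  show "F ` winning_moves G = F ` winning_moves G'"
    using 1 2 unfolding winning_moves_def
    by (intro equalityI image_subsetI) (metis (mono_tags, lifting) imageI mem_Collect_eq)+
qed

lemma candies_permuted:
  assumes "mset G = mset G'"
  shows "luca_candies G = luca_candies G' \<and> windsor_candies G = windsor_candies G'"
  using assms
proof (induction "sum_list G" arbitrary: G G' rule: less_induct)
  case less
  have sum: "sum_list H = sum_list H'" if "mset H = mset H'" for H H' :: "nat list"
    using that by (metis sum_mset_sum_list)
  have IH: "luca_candies H = luca_candies H'" "windsor_candies H = windsor_candies H'"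
    if "H \<in> nim_moves G" "mset H = mset H'" for H H'
    using less.hyps[OF sum_list_nim_moves[OF that(1)] that(2)] by auto
  note image = image_nim_moves_permuted[OF less.prems]
  have "nim_moves G = {} \<longleftrightarrow> nim_moves G' = {}"
    using image(1)[of "\<lambda>_. ()"] by (metis image_is_empty)
  moreover note P_position_permuted[OF less.prems] sum[OF less.prems]
  moreover have
    "luca_candies ` winning_moves G = luca_candies ` winning_moves G'"
    "windsor_candies ` nim_moves G = windsor_candies ` nim_moves G'"
    by (rule image(2) image(1), erule (1) IH)+
  moreover have
    "(\<lambda>H. (sum_list G - sum_list H) + luca_candies H) ` nim_moves G
     = (\<lambda>H. (sum_list G - sum_list H) + luca_candies H) ` nim_moves G'"
    by (rule image(1)) (use IH sum in metis)
  moreover have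
    "(\<lambda>H. (sum_list G - sum_list H) + windsor_candies H) ` winning_moves G
     = (\<lambda>H. (sum_list G - sum_list H) + windsor_candies H) ` winning_moves G'"
    by (rule image(2)) (use IH sum in metis)
  ultimately show ?case
    by (simp add: luca_candies.simps[of G] luca_candies.simps[of G']
        windsor_candies.simps[of G] windsor_candies.simps[of G'])
qed

lemma candy_value_permuted: "mset G = mset G' \<Longrightarrow> candy_value G = candy_value G'"
  by (simp add: candy_value_def candies_permuted[of G G'])

section \<open>Positions with a forced reply\<close>

lemma finite_nim_moves: "finite (nim_moves G)"
proof -
  have "nim_moves G = (\<Union>i<length G. (\<lambda>j. G[i := j]) ` {..<G ! i})"
    by (auto simp: nim_moves_def)
  then show ?thesis
    by simp
qed

text \<open>
  Luca can force the line \<open>G\<close>, \<open>H\<close>, \<open>W\<close> because Windsor has no alternative at \<open>H\<close>. Along it Luca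
  collects \<open>sum_list G - sum_list H\<close> candies and Windsor \<open>sum_list H - sum_list W\<close>.
\<close>

lemma candy_value_ge_forced_reply:
  assumes "P_position G" and H: "H \<in> nim_moves G"
    and "\<not> P_position H" and W: "winning_moves H = {W}"
  shows "candy_value W + int (sum_list G) + int (sum_list W) - 2 * int (sum_list H) \<le> candy_value G"
proof -
  have WH: "W \<in> nim_moves H"
    using W by (auto simp: winning_moves_def)
  have ne: "nim_moves G \<noteq> {}" "nim_moves H \<noteq> {}"
    using H WH by auto
  have less: "sum_list H < sum_list G" "sum_list W < sum_list H"
    using H WH by (simp_all add: sum_list_nim_moves)
  have "luca_candies H = luca_candies W"
    using ne assms(3) W by (subst luca_candies.simps) simp
  moreover have "windsor_candies H = (sum_list H - sum_list W) + windsor_candies W"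
    using ne assms(3) W by (subst windsor_candies.simps) simp
  moreover have "(sum_list G - sum_list H) + luca_candies H \<le> luca_candies G"
    using ne assms(1) H
    by (subst (2) luca_candies.simps) (simp add: finite_nim_moves)
  moreover have "windsor_candies G \<le> windsor_candies H"
    using ne assms(1) H
    by (subst windsor_candies.simps) (simp add: finite_nim_moves)
  ultimately show ?thesis
    using less unfolding candy_value_def by linarith
qed

section \<open>Nim-sums of three piles\<close>

lemma mask_xor_nat:
  fixes q y :: nat
  assumes "y < 2 ^ K"
  shows "(2 ^ K - 1) XOR (2 ^ K * q + y) = 2 ^ K * q + (2 ^ K - 1 - y)"
  using assms
proof (induction K arbitrary: y)
  case (Suc K)
  have "y div 2 < 2 ^ K"
    using Suc.prems by auto
  note IH = Suc.IH[OF this]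
  have half: "(2 ^ Suc K - 1) div 2 = 2 ^ K - (1::nat)"
    unfolding power_Suc by presburger
  have half': "(2 ^ Suc K * q + y) div 2 = 2 ^ K * q + y div 2"
    by simp
  have odd: "odd (2 ^ Suc K - 1 :: nat)"
    by simp
  have parity: "even (2 ^ Suc K * q + y) \<longleftrightarrow> even y"
    by simp
  have "(2 ^ Suc K - 1) XOR (2 ^ Suc K * q + y)
      = of_bool (even y) + 2 * (2 ^ K * q + (2 ^ K - 1 - y div 2))"
    by (subst xor_nat_rec)
      (use odd parity in \<open>simp add: half half' IH del: power_Suc One_nat_def\<close>)
  also have "\<dots> = 2 ^ Suc K * q + (2 ^ Suc K - 1 - y)"
    using Suc.prems by (cases "even y") (auto elim!: evenE oddE)
  finally show ?case .
qed simp

lemma P_position_triple_iff: "P_position [a, b, c] \<longleftrightarrow> a XOR b = c"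
proof -
  have "P_position [a, b, c] \<longleftrightarrow> (a XOR b) XOR c = 0"
    by (simp add: P_position_def nim_sum_def xor.assoc)
  then show ?thesis
    by (metis xor.assoc xor.left_neutral xor.right_neutral xor_self_eq)
qed

text \<open>
  Division by \<open>2 ^ K\<close> drops the low bits. Consequently a pile smaller than \<open>2 ^ K\<close> cannot balance
  two piles whose quotients by \<open>2 ^ K\<close> differ.
\<close>

lemma xor_div_exp_nat: "(a XOR b) div 2 ^ K = (a div 2 ^ K) XOR (b div 2 ^ K)" for a b :: nat
  by (simp only: drop_bit_xor flip: drop_bit_eq_div)

text \<open>
  Of the three piles, the first is too small to match the top bits of the other two, and the third
  would have to grow to \<open>2 ^ K * (m + 1) + (2 ^ K - 1 - x)\<close>. Only the middle pile can restore a
  zero nim-sum.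
\<close>

lemma winning_moves_unbalanced_triple:
  fixes m x y :: nat
  assumes x: "x < 2 ^ K" and y: "y < 2 ^ K"
  defines "H \<equiv> [2 ^ K - 1, 2 ^ K * (m + 1) + x, 2 ^ K * m + y]"
  shows "\<not> P_position H"
    and "winning_moves H = {[2 ^ K - 1, 2 ^ K * m + (2 ^ K - 1 - y), 2 ^ K * m + y]}"
      (is "_ = {?W}")
proof -
  have M: "(2 ^ K - 1) XOR (2 ^ K * (m + 1) + x) = 2 ^ K * (m + 1) + (2 ^ K - 1 - x)"
    by (rule mask_xor_nat[OF x])
  have gt: "2 ^ K * m + y < 2 ^ K * (m + 1) + z" for z
    using y by simp
  show "\<not> P_position H"
    unfolding H_def P_position_triple_iff M using gt by (metis less_irrefl)
  have small_pile: "\<not> P_position [j, 2 ^ K * (m + 1) + x, 2 ^ K * m + y]" if "j < 2 ^ K - 1" for j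
  proof
    assume "P_position [j, 2 ^ K * (m + 1) + x, 2 ^ K * m + y]"
    then have "j XOR (2 ^ K * (m + 1) + x) = 2 ^ K * m + y"
      by (simp only: P_position_triple_iff)
    then have eq: "(j div 2 ^ K) XOR ((2 ^ K * (m + 1) + x) div 2 ^ K) = (2 ^ K * m + y) div 2 ^ K"
      by (simp only: flip: xor_div_exp_nat)
    have "(2 ^ K * l + z) div 2 ^ K = l" if "z < 2 ^ K" for l z :: nat
      using that by simp
    note quot = this[OF x, of "m + 1"] this[OF y, of m]
    have "j div 2 ^ K = 0"
      using that by simp
    with eq have "m + 1 = m"
      by (simp only: quot xor.left_neutral)
    then show False
      by simp
  qed
  have last_pile: "\<not> P_position [2 ^ K - 1, 2 ^ K * (m + 1) + x, j]" if "j < 2 ^ K * m + y" for j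
    unfolding P_position_triple_iff M using that gt by (metis less_asym)
  have middle_pile: "P_position [2 ^ K - 1, j, 2 ^ K * m + y] \<longleftrightarrow> j = 2 ^ K * m + (2 ^ K - 1 - y)" for j
    unfolding P_position_triple_iff mask_xor_nat[OF y, symmetric]
    by (metis xor.assoc xor.left_neutral xor_self_eq)
  show "winning_moves H = {?W}"
  proof (intro equalityI subsetI)
    fix W assume "W \<in> winning_moves H"
    then obtain i j where "i < length H" "j < H ! i" "W = H[i := j]" "P_position W"
      unfolding winning_moves_def nim_moves_def by blast
    then consider "j < 2 ^ K - 1" "W = [j, 2 ^ K * (m + 1) + x, 2 ^ K * m + y]"
      | "W = [2 ^ K - 1, j, 2 ^ K * m + y]"
      | "j < 2 ^ K * m + y" "W = [2 ^ K - 1, 2 ^ K * (m + 1) + x, j]"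
      by (auto simp: H_def less_Suc_eq)
    then show "W \<in> {?W}"
      using small_pile last_pile middle_pile \<open>P_position W\<close> by cases blast+
  next
    fix W assume "W \<in> {?W}"
    then have W: "W = H[1 := 2 ^ K * m + (2 ^ K - 1 - y)]"
      by (simp add: H_def)
    have "2 ^ K * m + (2 ^ K - 1 - y) < H ! 1"
      using y by (simp add: H_def)
    then have "W \<in> nim_moves H"
      unfolding nim_moves_def W by (force simp: H_def)
    then show "W \<in> winning_moves H"
      using middle_pile by (simp add: winning_moves_def W H_def)
  qed
qed

section \<open>Descending by one level\<close>

text \<open>
  For offsets below half of \<open>2 ^ K\<close>, Luca shrinks the larger of the last two piles until it is the
  smaller one at the level below, while Windsor has to shrink the smaller pile only to the larger
  one of that level. This crossing is the source of Luca's profit.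
\<close>

lemma candy_value_descend:
  fixes m x y :: nat
  assumes x: "x < 2 ^ K" and y: "y < 2 ^ K"
  shows "candy_value [2 ^ K - 1, 2 ^ K * m + y, 2 ^ K * m + (2 ^ K - 1 - y)]
           + 2 * (2 ^ K - 1) - 2 * int x - 2 * int y
       \<le> candy_value [2 ^ K - 1, 2 ^ K * (m + 1) + x, 2 ^ K * (m + 1) + (2 ^ K - 1 - x)]"
    (is "candy_value ?W' + _ - _ - _ \<le> candy_value ?G")
proof -
  let ?H = "[2 ^ K - 1, 2 ^ K * (m + 1) + x, 2 ^ K * m + y]"
  let ?W = "[2 ^ K - 1, 2 ^ K * m + (2 ^ K - 1 - y), 2 ^ K * m + y]"
  have "P_position ?G"
    by (simp only: P_position_triple_iff mask_xor_nat[OF x])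
  moreover have "?H \<in> nim_moves ?G"
  proof -
    have "?H = ?G[2 := 2 ^ K * m + y]" "2 < length ?G" "2 ^ K * m + y < ?G ! 2"
      using y by simp_all
    then show ?thesis
      unfolding nim_moves_def by blast
  qed
  ultimately have "candy_value ?W + int (sum_list ?G) + int (sum_list ?W) - 2 * int (sum_list ?H)
      \<le> candy_value ?G"
    by (rule candy_value_ge_forced_reply) (rule winning_moves_unbalanced_triple[OF x y])+
  moreover have "candy_value ?W = candy_value ?W'"
    by (rule candy_value_permuted) simp
  moreover have "int (sum_list ?G) + int (sum_list ?W) - 2 * int (sum_list ?H)
      = 2 * (2 ^ K - 1) - 2 * int x - 2 * int y"
    using x y by (simp add: of_nat_diff algebra_simps)
  ultimately show ?thesis
    by linarith
qed

theorem theorem5p3: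
  fixes k m x :: nat and G :: "nat list"
  assumes "m \<ge> 1"
    and "x < 2 ^ k"
    and "G = frak_G (2 ^ (k + 1) - 1) m x"
  shows "candy_value (frak_G (2 ^ (k + 1) - 1) (m - 1) 0) + 2 * (2 ^ (k + 1) - 1) - 2 * int x
           \<le> candy_value G \<and>
         candy_value G
           \<le> candy_value (frak_G (2 ^ (k + 1) - 1) (m + 1) 0) - 2 * (2 ^ (k + 1) - 1) + 2 * int x"
proof -
  have frak: "frak_G (2 ^ (k + 1) - 1) l z
      = [2 ^ (k + 1) - 1, 2 ^ (k + 1) * l + z, 2 ^ (k + 1) * l + (2 ^ (k + 1) - 1 - z)]"
    if "z < 2 ^ k" for l z
    using frak_G_mersenne[OF that, of l] that by simp
  have x: "x < 2 ^ (k + 1)" and zero: "0 < (2::nat) ^ k" "0 < (2::nat) ^ (k + 1)"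
    using assms(2) by simp_all
  have m: "m - 1 + 1 = m"
    using assms(1) by simp
  show ?thesis
    using candy_value_descend[OF x zero(2), of "m - 1"] candy_value_descend[OF zero(2) x, of m]
    unfolding assms(3) frak[OF assms(2)] frak[OF zero(1)] m by linarith
qed

end
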